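(* Let $f:\mathbb{R}^k\to\mathbb{R}$ be twice differentiable, $L$-smooth ($L>0$) and convex, with a minimizer $x^*$, and suppose $f(x)=\sum_{i=1}^kf_i(x^{(i)})$ for functions $f_i:\mathbb{R}\to\mathbb{R}$. Let $0<\alpha<1$, $\beta\in\mathbb{R}$, $\gamma=\frac{1-\alpha}{2-\alpha}$, and set $$K_1=\tfrac{L}{2}(\beta-\gamma),\qquad K_2=\begin{cases}\tfrac{L}{2}(\beta+\gamma)&\text{if }\beta\ge0,\\ -\tfrac{L}{2}(\beta-\gamma)&\text{if }\beta\le0.\end{cases}$$ Let $\lambda\in\mathbb{R}$ satisfy $1-\lambda K_1>\frac{\sqrt2+1}{\sqrt2-1}|\lambda|K_2$. Let $x_0\in\mathbb{R}^k$ and define, for $t\ge0$, $$x_{t+1}=x_t-\eta\,{}^{C}\delta^{\alpha,\beta}_{c_t}f(x_t),\qquad \eta=\frac1L\left[\frac{2(1-\lambda K_1-|\lambda|K_2)}{(1-\lambda K_1+|\lambda|K_2)^2}-\frac{1}{1-\lambda K_1-|\lambda|K_2}\right],\qquad x_t-c_t=-\lambda\nabla f(x_t).$$ For $T\ge1$ let $\bar x_T=\frac1T\sum_{t=1}^Tx_t$. Then $$f(\bar x_T)-f(x^* )\le\frac{L\|x_0-x^*\|_2^2}{\left(4\left(\frac{1-\lambda K_1-|\lambda|K_2}{1-\lambda K_1+|\lambda|K_2}\right)^2-2\right)T}.$$ In particular, this rate is at best the same as that of gradient descent: the coefficient of $\frac{\|x_0-x^*\|_2^2}{T}$ is at least $\frac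 L2$.
   Context: $x^{(i)}$ denotes the $i$th coordinate of $x\in\mathbb{R}^k$. $f:\mathbb{R}^k\to\mathbb{R}$ is $L$-smooth if $|f(y)-f(x)-\langle\nabla f(x),y-x\rangle|\le\frac L2\|y-x\|_2^2$ for all $x,y$. For $g:\mathbb{R}\to\mathbb{R}$, non-integer $\nu>0$, $n=\lceil\nu\rceil$ and real $x\ne c$, the Caputo derivative is $${}^{C}D^{\nu}_{c}g(x)=\frac{(\operatorname{sgn}(x-c))^{n-1}}{\Gamma(n-\nu)}\int_c^x\frac{g^{(n)}(t)}{|x-t|^{\nu-n+1}}\,dt ,$$ with $\operatorname{sgn}$ the sign function, $\Gamma$ the gamma function, and $\int_c^x$ the oriented integral. For $\alpha\in(0,1)$, $\beta\in\mathbb{R}$, real $x\neq c$, $${}^{C}\delta^{\alpha,\beta}_{c}g(x)=\frac{\Gamma(2-\alpha)|x-c|^{\alpha}}{x-c}\Big({}^{C}D^{\alpha}_{c}g(x)+\beta|x-c|\,{}^{C}D^{1+\alpha}_{c}g(x)\Big),$$ and for $c=x$ it is read as its limiting value $g'(x)$. For $f:\mathbb{R}^k\to\mathbb{R}$ and $x,c\in\mathbb{R}^k$, $${}^{C}\delta^{\alpha,\beta}_{c}f(x)=\big[{}^{C}\delta^{\alpha,\beta}_{c^{(1)}}f_{1,x}(x^{(1)}),\dots,{}^{C}\delta^{\alpha,\beta}_{c^{(k)}}f_{k,x}(x^{(k)})\big],\qquad f_{j,x}(y)=f\big(x+(y-x^{(j)})e^{(j)}\big),$$ where $e^{(j)}$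 is the $j$th standard unit vector. *)

theory Defs
  imports "HOL-Analysis.Analysis"
begin

definition grad :: "('a::real_inner \<Rightarrow> real) \<Rightarrow> 'a \<Rightarrow> 'a" where
  "grad f x = (THE D. GDERIV f x :> D)"

lemma grad_eqI: "GDERIV f x :> D \<Longrightarrow> grad f x = D"
  unfolding grad_def gderiv_def
  by (rule the_equality) (auto dest: has_derivative_unique[of f _ x "\<lambda>h. h \<bullet> D"]
      simp: fun_eq_iff vector_eq_ldot)

lemma GDERIV_grad:
  fixes f :: "'a::euclidean_space \<Rightarrow> real"
  assumes "f differentiable (at x)"
  shows "GDERIV f x :> grad f x"
proof -
  obtain F where F: "(f has_derivative F) (at x)"
    using assms by (auto simp: differentiable_def)
  then interpret F: bounded_linear F
    by (rule has_derivative_bounded_linear)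
  have "F = (\<lambda>h. h \<bullet> (\<Sum>b\<in>Basis. F b *\<^sub>R b))"
  proof
    fix h
    have "F h = F (\<Sum>b\<in>Basis. (h \<bullet> b) *\<^sub>R b)"
      by (simp add: euclidean_representation)
    then show "F h = h \<bullet> (\<Sum>b\<in>Basis. F b *\<^sub>R b)"
      by (simp add: F.sum F.scaleR inner_sum_right mult.commute)
  qed
  with F have "GDERIV f x :> (\<Sum>b\<in>Basis. F b *\<^sub>R b)"
    by (simp add: gderiv_def)
  then show ?thesis
    using grad_eqI by metis
qed

definition twice_differentiable :: "('a::real_inner \<Rightarrow> real) \<Rightarrow> bool" where
  "twice_differentiable f \<longleftrightarrow>
     (\<forall>x. f differentiable (at x)) \<and> (\<forall>x. grad f differentiable (at x))"

text \<open>To be used for differentiable \<open>f\<close> only: elsewhere \<^const>\<open>grad\<close> is unspecified.\<close>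

definition L_smooth :: "real \<Rightarrow> ('a::real_inner \<Rightarrow> real) \<Rightarrow> bool" where
  "L_smooth L f \<longleftrightarrow>
     (\<forall>x y. \<bar>f y - f x - grad f x \<bullet> (y - x)\<bar> \<le> L / 2 * (norm (y - x))\<^sup>2)"

text \<open>Meaningful for non-integer \<open>\<nu> > 0\<close> and \<open>x \<noteq> c\<close>. The integral is the oriented Lebesgue
  integral from \<open>c\<close> to \<open>x\<close>; the value of the integrand at the singularity \<open>t = x\<close>, which is \<open>0\<close>
  because of \<open>a / 0 = 0\<close>, is irrelevant.\<close>

definition caputo_deriv :: "real \<Rightarrow> real \<Rightarrow> (real \<Rightarrow> real) \<Rightarrow> real \<Rightarrow> real" where
  "caputo_deriv \<nu> c g x =
     (let n = nat \<lceil>\<nu>\<rceil> in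
        sgn (x - c) ^ (n - 1) / Gamma (real n - \<nu>) *
        (LBINT t=c..x. (deriv ^^ n) g t / \<bar>x - t\<bar> powr (\<nu> - real n + 1)))"

text \<open>At \<open>x = c\<close> the operator takes its limiting value \<open>g' x\<close>.\<close>

definition caputo_delta :: "real \<Rightarrow> real \<Rightarrow> real \<Rightarrow> (real \<Rightarrow> real) \<Rightarrow> real \<Rightarrow> real" where
  "caputo_delta \<alpha> \<beta> c g x =
     (if x = c then deriv g x
      else Gamma (2 - \<alpha>) * \<bar>x - c\<bar> powr \<alpha> / (x - c) *
             (caputo_deriv \<alpha> c g x + \<beta> * \<bar>x - c\<bar> * caputo_deriv (1 + \<alpha>) c g x))"

definition coord_restrict :: "(real ^ 'k \<Rightarrow> real) \<Rightarrow> 'k::finite \<Rightarrow> real ^ 'k \<Rightarrow> real \<Rightarrow> real" where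
  "coord_restrict f j x y = f (x + (y - x $ j) *\<^sub>R axis j 1)"

definition caputo_grad ::
    "real \<Rightarrow> real \<Rightarrow> real ^ 'k \<Rightarrow> (real ^ 'k \<Rightarrow> real) \<Rightarrow> real ^ 'k \<Rightarrow> real ^ 'k::finite" where
  "caputo_grad \<alpha> \<beta> c f x =
     (\<chi> j. caputo_delta \<alpha> \<beta> (c $ j) (coord_restrict f j x) (x $ j))"

end

theory Submission
  imports Defs
begin

text \<open>
  On a coordinate function \<open>g\<close> with \<open>0 \<le> g'' \<le> L\<close>, the Caputo operator is a perturbed derivative.
  Integrating the first-order term by parts, with \<open>a = x - c\<close> positive, turns it into
  \<open>g' x + a powr (\<alpha> - 1) * (\<integral> g'' t * W t)\<close> over \<open>[c, x]\<close>, where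
  \<open>W t = (x - t) powr (1 - \<alpha>) - a powr (1 - \<alpha>) + \<beta> * (1 - \<alpha>) * a * (x - t) powr - \<alpha>\<close>.
  Splitting \<open>g''\<close> into its mid-range value \<open>L / 2\<close> and a deviation of modulus at most \<open>L / 2\<close>, the
  first part contributes \<open>K1 * (x - c)\<close> exactly and the second at most \<open>K2 * \<bar>x - c\<bar>\<close>
  (\<open>caputo_delta_approx\<close>). With \<open>x - c = - lam * g' x\<close>, the operator is therefore \<open>g' x\<close> times a factor
  in \<open>[m, M]\<close>, where \<open>m = 1 - lam * K1 - \<bar>lam\<bar> * K2\<close> and \<open>M = 1 - lam * K1 + \<bar>lam\<bar> * K2\<close>.

  Since \<open>f\<close> is separable, the iteration runs independently in each coordinate and is there gradient
  descent with a step size that varies within \<open>[\<eta> * m, \<eta> * M]\<close>. The hypothesis on \<open>lam\<close> says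
  \<open>M < sqrt 2 * m\<close>, which makes \<open>\<eta>\<close> positive, and always \<open>\<eta> * M \<le> 1 / L\<close>, so that the classical
  estimate for a gradient step applies (\<open>scaled_gradient_step\<close>). Each coordinate of the minimizer of
  \<open>f\<close> minimizes the corresponding coordinate function, so every coordinate contributes a nonnegative
  gap to \<open>f (x t) - f xstar\<close>, and the varying step size that multiplies this gap may be lowered to
  \<open>\<eta> * m\<close>. This uniform factor lets the
  coordinates be added up; telescoping and Jensen's inequality bound the gap of the
  average by \<open>(norm (x 0 - xstar))\<^sup>2 / (2 * \<eta> * m * T)\<close> (\<open>average_iterate_bound\<close>), and
  \<open>2 * \<eta> * m = (4 * (m / M)\<^sup>2 - 2) / L\<close>. Since \<open>m \<le> M\<close>, this is at most \<open>2 / L\<close>, so the coefficient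
  cannot drop below \<open>L / 2\<close>.
\<close>

section \<open>Integrals against the Caputo kernel\<close>

text \<open>The second derivative of a coordinate function need not be continuous, so its Borel
  measurability rests on its being a pointwise limit of continuous difference quotients.\<close>

lemma borel_measurable_derivative:
  fixes g g' :: "real \<Rightarrow> real"
  assumes "\<And>t. (g has_real_derivative g' t) (at t)"
  shows "g' \<in> borel_measurable borel"
proof (rule borel_measurable_LIMSEQ_real)
  have cont: "continuous_on UNIV g"
    using assms by (meson DERIV_isCont continuous_at_imp_continuous_on)
  have [measurable]: "g \<in> borel_measurable borel"
    by (rule borel_measurable_continuous_onI[OF cont])
  show "(\<lambda>t. (g (t + inverse (real (Suc n))) - g t) / inverse (real (Suc n)))
      \<in> borel_measurable borel" for n
    by measurable
  show "(\<lambda>n. (g (t + inverse (real (Suc n))) - g t) / inverse (real (Suc n))) \<longlonglongrightarrow> g' t" for t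
  proof -
    have "filterlim (\<lambda>n. inverse (real (Suc n))) (at 0) sequentially"
      unfolding filterlim_at using LIMSEQ_inverse_real_of_nat by auto
    with assms[of t] show ?thesis
      unfolding DERIV_def by (rule filterlim_compose)
  qed
qed

lemma DERIV_caputo_kernel:
  fixes t x p :: real
  assumes "t < x"
  shows "((\<lambda>t. (x - t) powr p) has_real_derivative - (p * (x - t) powr (p - 1))) (at t)"
  using assms by (auto intro!: derivative_eq_intros simp: powr_diff)

lemma caputo_kernel_has_integral:
  fixes c x p :: real
  assumes "c < x" "p > -1"
  shows "((\<lambda>t. (x - t) powr p) has_integral (x - c) powr (p + 1) / (p + 1)) {c..x}"
proof -
  have "((\<lambda>t. (x - t) powr p) has_integral
      (- ((x - x) powr (p + 1) / (p + 1)) - - ((x - c) powr (p + 1) / (p + 1)))) {c..x}"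
  proof (rule fundamental_theorem_of_calculus_interior)
    show "continuous_on {c..x} (\<lambda>t. - ((x - t) powr (p + 1) / (p + 1)))"
      using assms by (intro continuous_intros continuous_on_powr') auto
    show "((\<lambda>t. - ((x - t) powr (p + 1) / (p + 1))) has_vector_derivative (x - t) powr p) (at t)"
      if "t \<in> {c<..<x}" for t
      unfolding has_real_derivative_iff_has_vector_derivative[symmetric]
    proof -
      have "((\<lambda>t. (x - t) powr (p + 1)) has_real_derivative - ((p + 1) * (x - t) powr p)) (at t)"
        using DERIV_caputo_kernel[of t x "p + 1"] that by simp
      from DERIV_minus[OF DERIV_cdivide[OF this, of "p + 1"]]
      show "((\<lambda>t. - ((x - t) powr (p + 1) / (p + 1))) has_real_derivative (x - t) powr p) (at t)"
        using assms by simp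
    qed
  qed (use assms in auto)
  then show ?thesis using assms by simp
qed

lemma caputo_kernel_set_integrable:
  fixes h :: "real \<Rightarrow> real"
  assumes "c < x" "0 < \<alpha>" "\<alpha> < 1"
    and [measurable]: "h \<in> borel_measurable borel"
    and bd: "\<And>t. t \<in> {c..x} \<Longrightarrow> \<bar>h t\<bar> \<le> B"
  shows "set_integrable lborel {c..x} (\<lambda>t. h t / \<bar>x - t\<bar> powr \<alpha>)"
proof -
  have "(\<lambda>t. (x - t) powr - \<alpha>) integrable_on {c..x}"
    using caputo_kernel_has_integral[of c x "- \<alpha>"] assms(1,3)
    by (simp add: has_integral_integrable)
  then have "(\<lambda>t. (x - t) powr - \<alpha>) absolutely_integrable_on {c..x}"
    by (rule nonnegative_absolutely_integrable_1) auto
  then have "set_integrable lborel {c..x} (\<lambda>t. (x - t) powr - \<alpha>)"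
    unfolding set_integrable_def
    by (subst (asm) integrable_completion) auto
  then have "set_integrable lborel {c..x} (\<lambda>t. B * (x - t) powr - \<alpha>)"
    by simp
  then show ?thesis
  proof (rule set_integrable_bound)
    show "set_borel_measurable lborel {c..x} (\<lambda>t. h t / \<bar>x - t\<bar> powr \<alpha>)"
      unfolding set_borel_measurable_def by measurable
    show "AE t in lborel. t \<in> {c..x} \<longrightarrow>
        norm (h t / \<bar>x - t\<bar> powr \<alpha>) \<le> norm (B * (x - t) powr - \<alpha>)"
    proof (intro AE_I2 impI)
      fix t assume t: "t \<in> {c..x}"
      have "\<bar>h t\<bar> * (x - t) powr - \<alpha> \<le> \<bar>B\<bar> * (x - t) powr - \<alpha>"
        using bd[OF t] by (intro mult_right_mono) auto
      then show "norm (h t / \<bar>x - t\<bar> powr \<alpha>) \<le> norm (B * (x - t) powr - \<alpha>)"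
        using t by (simp add: abs_mult powr_minus divide_inverse)
    qed
  qed
qed

text \<open>Passing from the Lebesgue to the gauge integral: the fundamental theorem of calculus for the
  latter holds for derivatives that are not continuous.\<close>

lemma LBINT_caputo_kernel:
  fixes h :: "real \<Rightarrow> real"
  assumes "c < x" "0 < \<alpha>" "\<alpha> < 1"
    and "h \<in> borel_measurable borel"
    and "\<And>t. t \<in> {c..x} \<Longrightarrow> \<bar>h t\<bar> \<le> B"
  shows "((\<lambda>t. h t * (x - t) powr - \<alpha>) has_integral (LBINT t=c..x. h t / \<bar>x - t\<bar> powr \<alpha>)) {c..x}"
proof -
  note si = caputo_kernel_set_integrable[OF assms]
  have "((\<lambda>t. h t / \<bar>x - t\<bar> powr \<alpha>) has_integral (LBINT t=c..x. h t / \<bar>x - t\<bar> powr \<alpha>)) {c..x}"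
    using set_borel_integral_eq_integral[OF si] interval_integral_eq_integral[OF _ si] assms(1)
    by (simp add: has_integral_integral)
  then show ?thesis
    by (rule has_integral_eq[rotated]) (simp add: powr_minus divide_inverse)
qed

section \<open>The Caputo operator as a perturbed derivative\<close>

lemma caputo_delta_unfold:
  fixes g :: "real \<Rightarrow> real"
  assumes g: "\<And>t. (g has_real_derivative g' t) (at t)"
    and g': "\<And>t. (g' has_real_derivative g'' t) (at t)"
    and \<alpha>: "0 < \<alpha>" "\<alpha> < 1" and "x \<noteq> c"
  shows "caputo_delta \<alpha> \<beta> c g x = (1 - \<alpha>) * \<bar>x - c\<bar> powr \<alpha> / (x - c) *
    ((LBINT t=c..x. g' t / \<bar>x - t\<bar> powr \<alpha>)
      + \<beta> * (x - c) * (LBINT t=c..x. g'' t / \<bar>x - t\<bar> powr \<alpha>))"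
proof -
  have d: "deriv g = g'" "deriv g' = g''"
    using g g' by (auto intro!: ext DERIV_imp_deriv)
  have c1: "\<lceil>\<alpha>\<rceil> = 1" and c2: "\<lceil>1 + \<alpha>\<rceil> = 2"
    using \<alpha> by (auto simp: ceiling_eq_iff)
  have "1 - \<alpha> \<notin> \<int>\<^sub>\<le>\<^sub>0"
    using \<alpha> by (metis diff_gt_0_iff_gt nonpos_Ints_nonpos not_le)
  then have G: "Gamma (2 - \<alpha>) = (1 - \<alpha>) * Gamma (1 - \<alpha>)" "Gamma (1 - \<alpha>) > 0"
    using Gamma_plus1[of "1 - \<alpha>"] Gamma_real_pos[of "1 - \<alpha>"] \<alpha> by auto
  have s: "\<bar>x - c\<bar> * sgn (x - c) = x - c"
    by (rule abs_mult_sgn)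
  have D1: "caputo_deriv \<alpha> c g x = (LBINT t=c..x. g' t / \<bar>x - t\<bar> powr \<alpha>) / Gamma (1 - \<alpha>)"
    by (simp add: caputo_deriv_def c1 d)
  have D2: "\<bar>x - c\<bar> * caputo_deriv (1 + \<alpha>) c g x =
      (x - c) * (LBINT t=c..x. g'' t / \<bar>x - t\<bar> powr \<alpha>) / Gamma (1 - \<alpha>)"
    using s by (simp add: caputo_deriv_def c2 d numeral_2_eq_2)
  have "caputo_delta \<alpha> \<beta> c g x = Gamma (2 - \<alpha>) * \<bar>x - c\<bar> powr \<alpha> / (x - c) *
      (caputo_deriv \<alpha> c g x + \<beta> * (\<bar>x - c\<bar> * caputo_deriv (1 + \<alpha>) c g x))"
    using \<open>x \<noteq> c\<close> by (simp add: caputo_delta_def mult.assoc)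
  also have "\<dots> = (1 - \<alpha>) * \<bar>x - c\<bar> powr \<alpha> / (x - c) *
    ((LBINT t=c..x. g' t / \<bar>x - t\<bar> powr \<alpha>)
      + \<beta> * (x - c) * (LBINT t=c..x. g'' t / \<bar>x - t\<bar> powr \<alpha>))"
  proof -
    have "a * G * p / D * (i / G + \<beta> * (D * k / G)) = a * p / D * (i + \<beta> * D * k)"
      if "G > 0" for a G p D i k :: real
    proof -
      have "i / G + \<beta> * (D * k / G) = (i + \<beta> * D * k) / G"
        by (simp add: add_divide_distrib)
      then show ?thesis using that by simp
    qed
    from this[OF G(2)] show ?thesis
      unfolding D1 D2 G(1) .
  qed
  finally show ?thesis .
qed

lemma DERIV_reflect:
  fixes h :: "real \<Rightarrow> real"
  assumes "\<And>t. (h has_real_derivative h' t) (at t)"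
  shows "((\<lambda>y. h (- y)) has_real_derivative - h' (- t)) (at t)"
  using assms DERIV_mirror by fastforce

text \<open>Reflection reverses the orientation of the integral. For order \<open>\<alpha>\<close> this is undone by the sign of
  the first derivative, for order \<open>1 + \<alpha>\<close> by the factor \<open>sgn (x - c)\<close>. Only the prefactor
  \<open>1 / (x - c)\<close> changes sign, and the case \<open>x < c\<close> reduces to \<open>c < x\<close>.\<close>

lemma caputo_delta_reflect:
  fixes g :: "real \<Rightarrow> real"
  assumes g: "\<And>t. (g has_real_derivative g' t) (at t)"
    and g': "\<And>t. (g' has_real_derivative g'' t) (at t)"
    and \<alpha>: "0 < \<alpha>" "\<alpha> < 1" and "x \<noteq> c"
  shows "caputo_delta \<alpha> \<beta> (- c) (\<lambda>y. g (- y)) (- x) = - caputo_delta \<alpha> \<beta> c g x"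
proof -
  have r1: "((\<lambda>y. g (- y)) has_real_derivative - g' (- t)) (at t)" for t
    by (rule DERIV_reflect[OF g])
  have r2: "((\<lambda>y. - g' (- y)) has_real_derivative g'' (- t)) (at t)" for t
    using DERIV_minus[OF DERIV_reflect[OF g']] by simp
  have refl: "(LBINT t=-c..-x. k (- t) / \<bar>- x - t\<bar> powr \<alpha>) = - (LBINT t=c..x. k t / \<bar>x - t\<bar> powr \<alpha>)"
    for k :: "real \<Rightarrow> real"
  proof -
    have "(LBINT t=-c..-x. k (- t) / \<bar>- x - t\<bar> powr \<alpha>) = (LBINT t=x..c. k t / \<bar>x - t\<bar> powr \<alpha>)"
      by (subst interval_integral_reflect) (simp add: abs_minus_commute)
    then show ?thesis by (simp add: interval_integral_endpoints_reverse[of x c])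
  qed
  have I1: "(LBINT t=-c..-x. - g' (- t) / \<bar>- x - t\<bar> powr \<alpha>) = (LBINT t=c..x. g' t / \<bar>x - t\<bar> powr \<alpha>)"
    using refl[of "\<lambda>t. - g' t"] by (simp flip: interval_lebesgue_integral_uminus)
  note I2 = refl[of g'']
  have "- x \<noteq> - c" using \<open>x \<noteq> c\<close> by simp
  show ?thesis
    unfolding caputo_delta_unfold[OF r1 r2 \<alpha> \<open>- x \<noteq> - c\<close>] caputo_delta_unfold[OF g g' \<alpha> \<open>x \<noteq> c\<close>] I1 I2
    using \<open>x \<noteq> c\<close> by (simp add: abs_minus_commute[of c x] divide_simps) (simp add: algebra_simps)
qed

text \<open>The weight \<open>W\<close> below has integral \<open>(\<beta> - \<gamma>) * a powr (2 - \<alpha>)\<close>, whence the main term. In the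
  error term, the difference of the two powers of order \<open>1 - \<alpha>\<close> is of constant sign and the kernel
  of order \<open>- \<alpha>\<close> is nonnegative, so \<open>\<bar>W\<bar>\<close> integrates to at most
  \<open>(\<bar>\<beta>\<bar> + \<gamma>) * a powr (2 - \<alpha>)\<close>.\<close>

lemma caputo_delta_approx_right:
  fixes g :: "real \<Rightarrow> real"
  assumes g: "\<And>t. (g has_real_derivative g' t) (at t)"
    and g': "\<And>t. (g' has_real_derivative g'' t) (at t)"
    and bd: "\<And>t. 0 \<le> g'' t" "\<And>t. g'' t \<le> L"
    and \<alpha>: "0 < \<alpha>" "\<alpha> < 1" and "c < x"
  defines "\<gamma> \<equiv> (1 - \<alpha>) / (2 - \<alpha>)"
  shows "\<bar>caputo_delta \<alpha> \<beta> c g x - g' x - L / 2 * (\<beta> - \<gamma>) * (x - c)\<bar>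
    \<le> L / 2 * (\<bar>\<beta>\<bar> + \<gamma>) * (x - c)"
proof -
  define a where "a = x - c"
  have a: "a > 0" using \<open>c < x\<close> by (simp add: a_def)
  define W where "W = (\<lambda>t. (x - t) powr (1 - \<alpha>) - a powr (1 - \<alpha>)
      + \<beta> * (1 - \<alpha>) * a * (x - t) powr - \<alpha>)"
  define V where "V = (\<lambda>t. L / 2 * (a powr (1 - \<alpha>) - (x - t) powr (1 - \<alpha>)
      + \<bar>\<beta>\<bar> * (1 - \<alpha>) * a * (x - t) powr - \<alpha>))"
  define I1 where "I1 = (LBINT t=c..x. g' t / \<bar>x - t\<bar> powr \<alpha>)"
  define I2 where "I2 = (LBINT t=c..x. g'' t / \<bar>x - t\<bar> powr \<alpha>)"
  have contg': "continuous_on S g'" for S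
    using g' by (meson DERIV_isCont continuous_at_imp_continuous_on)
  have "bounded (g' ` {c..x})"
    by (intro compact_imp_bounded compact_continuous_image contg') auto
  then obtain B where B: "\<And>t. t \<in> {c..x} \<Longrightarrow> \<bar>g' t\<bar> \<le> B"
    unfolding bounded_iff by (metis imageI real_norm_def)
  have J1: "((\<lambda>t. g' t * (x - t) powr - \<alpha>) has_integral I1) {c..x}"
    unfolding I1_def using LBINT_caputo_kernel[OF \<open>c < x\<close> \<alpha> borel_measurable_derivative[OF g] B] .
  have J2: "((\<lambda>t. g'' t * (x - t) powr - \<alpha>) has_integral I2) {c..x}"
    unfolding I2_def using bd
    by (intro LBINT_caputo_kernel[OF \<open>c < x\<close> \<alpha> borel_measurable_derivative[OF g'], of L]) auto
  have J3: "(g'' has_integral (g' x - g' c)) {c..x}"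
    using g' \<open>c < x\<close>
    by (intro fundamental_theorem_of_calculus)
      (auto simp: has_real_derivative_iff_has_vector_derivative[symmetric] intro: has_field_derivative_at_within)
  (* Integration by parts: the primitive - (x - t) powr (1 - \<alpha>) * g' t is continuous up to t = x
     and vanishes there. *)
  have J4: "((\<lambda>t. (1 - \<alpha>) * (x - t) powr - \<alpha> * g' t - (x - t) powr (1 - \<alpha>) * g'' t) has_integral
      (- ((x - x) powr (1 - \<alpha>) * g' x) - - ((x - c) powr (1 - \<alpha>) * g' c))) {c..x}"
  proof (rule fundamental_theorem_of_calculus_interior)
    show "continuous_on {c..x} (\<lambda>t. - ((x - t) powr (1 - \<alpha>) * g' t))"
      using \<alpha> by (intro continuous_intros continuous_on_powr' contg') auto
    show "((\<lambda>t. - ((x - t) powr (1 - \<alpha>) * g' t)) has_vector_derivative (1 - \<alpha>) * (x - t) powr - \<alpha> * g' t - (x - t) powr (1 - \<alpha>) * g'' t) (at t)"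
      if "t \<in> {c<..<x}" for t
      unfolding has_real_derivative_iff_has_vector_derivative[symmetric]
      using DERIV_minus[OF DERIV_mult[OF DERIV_caputo_kernel g'], of t x "1 - \<alpha>"] that
      by (simp add: algebra_simps)
  qed (use \<open>c < x\<close> in auto)
  (* The combination that cancels every g' t under the integral sign. *)
  have "((\<lambda>t. (1 - \<alpha>) * (g' t * (x - t) powr - \<alpha>)
        - ((1 - \<alpha>) * (x - t) powr - \<alpha> * g' t - (x - t) powr (1 - \<alpha>) * g'' t)
        - a powr (1 - \<alpha>) * g'' t + \<beta> * (1 - \<alpha>) * a * (g'' t * (x - t) powr - \<alpha>))
      has_integral ((1 - \<alpha>) * I1 - a powr (1 - \<alpha>) * g' c - a powr (1 - \<alpha>) * (g' x - g' c)
        + \<beta> * (1 - \<alpha>) * a * I2)) {c..x}"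
    using J4 \<alpha> by (intro has_integral_add has_integral_diff has_integral_mult_right J1 J2 J3)
      (simp add: a_def)
  then have JW: "((\<lambda>t. g'' t * W t) has_integral
      ((1 - \<alpha>) * (I1 + \<beta> * a * I2) - a powr (1 - \<alpha>) * g' x)) {c..x}"
    by (simp add: W_def algebra_simps)
  have P1: "((\<lambda>t. (x - t) powr - \<alpha>) has_integral a powr (1 - \<alpha>) / (1 - \<alpha>)) {c..x}"
    using caputo_kernel_has_integral[OF \<open>c < x\<close>, of "- \<alpha>"] \<alpha> by (simp add: a_def)
  have P2: "((\<lambda>t. (x - t) powr (1 - \<alpha>)) has_integral a powr (2 - \<alpha>) / (2 - \<alpha>)) {c..x}"
    using caputo_kernel_has_integral[OF \<open>c < x\<close>, of "1 - \<alpha>"] \<alpha> by (simp add: a_def)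
  have P3: "((\<lambda>t. a powr (1 - \<alpha>)) has_integral a * a powr (1 - \<alpha>)) {c..x}"
    using has_integral_const_real[of "a powr (1 - \<alpha>)" c x] \<open>c < x\<close> by (simp add: a_def)
  have pw: "a * a powr (1 - \<alpha>) = a powr (2 - \<alpha>)"
    using a powr_mult_base[of a "1 - \<alpha>"] by simp
  have "(W has_integral (a powr (2 - \<alpha>) / (2 - \<alpha>) - a * a powr (1 - \<alpha>)
      + \<beta> * (1 - \<alpha>) * a * (a powr (1 - \<alpha>) / (1 - \<alpha>)))) {c..x}"
    unfolding W_def by (intro has_integral_add has_integral_diff has_integral_mult_right P1 P2 P3)
  also have "(a powr (2 - \<alpha>) / (2 - \<alpha>) - a * a powr (1 - \<alpha>)
      + \<beta> * (1 - \<alpha>) * a * (a powr (1 - \<alpha>) / (1 - \<alpha>))) = (\<beta> - \<gamma>) * a powr (2 - \<alpha>)"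
    using \<alpha> by (simp add: pw[symmetric] \<gamma>_def) (simp add: field_simps)
  finally have JW0: "(W has_integral (\<beta> - \<gamma>) * a powr (2 - \<alpha>)) {c..x}" .
  have "(V has_integral (L / 2 * (a * a powr (1 - \<alpha>) - a powr (2 - \<alpha>) / (2 - \<alpha>)
      + \<bar>\<beta>\<bar> * (1 - \<alpha>) * a * (a powr (1 - \<alpha>) / (1 - \<alpha>))))) {c..x}"
    unfolding V_def by (intro has_integral_add has_integral_diff has_integral_mult_right P1 P2 P3)
  also have "L / 2 * (a * a powr (1 - \<alpha>) - a powr (2 - \<alpha>) / (2 - \<alpha>)
      + \<bar>\<beta>\<bar> * (1 - \<alpha>) * a * (a powr (1 - \<alpha>) / (1 - \<alpha>))) = L / 2 * (\<bar>\<beta>\<bar> + \<gamma>) * a powr (2 - \<alpha>)"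
    using \<alpha> by (simp add: pw[symmetric] \<gamma>_def) (simp add: field_simps)
  finally have JV: "(V has_integral L / 2 * (\<bar>\<beta>\<bar> + \<gamma>) * a powr (2 - \<alpha>)) {c..x}" .
  have JD: "((\<lambda>t. g'' t * W t - L / 2 * W t) has_integral
      ((1 - \<alpha>) * (I1 + \<beta> * a * I2) - a powr (1 - \<alpha>) * g' x
        - L / 2 * ((\<beta> - \<gamma>) * a powr (2 - \<alpha>)))) {c..x}"
    by (intro has_integral_diff has_integral_mult_right JW JW0)
  have le: "norm (g'' t * W t - L / 2 * W t) \<le> V t" if t: "t \<in> {c..x}" for t
  proof -
    have 1: "(x - t) powr (1 - \<alpha>) \<le> a powr (1 - \<alpha>)"
      using t \<alpha> by (intro powr_mono2) (auto simp: a_def)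
    have 2: "\<bar>\<beta> * (1 - \<alpha>) * a * (x - t) powr - \<alpha>\<bar> = \<bar>\<beta>\<bar> * (1 - \<alpha>) * a * (x - t) powr - \<alpha>"
      using \<alpha> a by (simp add: abs_mult)
    have "\<bar>W t\<bar> \<le> a powr (1 - \<alpha>) - (x - t) powr (1 - \<alpha>) + \<bar>\<beta>\<bar> * (1 - \<alpha>) * a * (x - t) powr - \<alpha>"
      unfolding W_def using 1 2 by linarith
    moreover have "\<bar>g'' t - L / 2\<bar> \<le> L / 2"
      using bd(1)[of t] bd(2)[of t] by linarith
    ultimately have "\<bar>g'' t - L / 2\<bar> * \<bar>W t\<bar> \<le> V t"
      unfolding V_def by (intro mult_mono) (linarith | simp)+
    then show ?thesis by (simp add: abs_mult[symmetric] left_diff_distrib)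
  qed
  have "norm (integral {c..x} (\<lambda>t. g'' t * W t - L / 2 * W t)) \<le> integral {c..x} V"
    using JD JV le by (intro integral_norm_bound_integral) auto
  then have bound: "\<bar>(1 - \<alpha>) * (I1 + \<beta> * a * I2) - a powr (1 - \<alpha>) * g' x
        - L / 2 * ((\<beta> - \<gamma>) * a powr (2 - \<alpha>))\<bar> \<le> L / 2 * (\<bar>\<beta>\<bar> + \<gamma>) * a powr (2 - \<alpha>)"
    using JD JV by (simp add: integral_unique)
  define P where "P = a powr (1 - \<alpha>)"
  have P: "P > 0" "a powr (2 - \<alpha>) = P * a"
    using a pw by (auto simp: P_def mult.commute)
  have "a powr \<alpha> * P = a" using a by (simp add: P_def powr_add[symmetric])
  then have Pa: "a powr \<alpha> / a = 1 / P" using a P by (simp add: field_simps)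
  have "caputo_delta \<alpha> \<beta> c g x = (1 - \<alpha>) * (\<bar>x - c\<bar> powr \<alpha> / (x - c)) * (I1 + \<beta> * (x - c) * I2)"
    using caputo_delta_unfold[OF g g' \<alpha>, of x c \<beta>] \<open>c < x\<close> by (simp add: I1_def I2_def)
  also have "\<dots> = (1 - \<alpha>) * (I1 + \<beta> * a * I2) / P"
    using Pa a by (simp add: a_def)
  finally have eq: "(1 - \<alpha>) * (I1 + \<beta> * a * I2) = P * caputo_delta \<alpha> \<beta> c g x"
    using P by simp
  have "\<bar>P * (caputo_delta \<alpha> \<beta> c g x - g' x - L / 2 * (\<beta> - \<gamma>) * a)\<bar>
      \<le> P * (L / 2 * (\<bar>\<beta>\<bar> + \<gamma>) * a)"
    using bound unfolding eq P(2) P_def[symmetric] by (simp add: algebra_simps diff_divide_distrib)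
  then show ?thesis
    using P by (simp add: abs_mult a_def)
qed

lemma caputo_delta_approx:
  fixes g :: "real \<Rightarrow> real"
  assumes g: "\<And>t. (g has_real_derivative g' t) (at t)"
    and g': "\<And>t. (g' has_real_derivative g'' t) (at t)"
    and bd: "\<And>t. 0 \<le> g'' t" "\<And>t. g'' t \<le> L"
    and \<alpha>: "0 < \<alpha>" "\<alpha> < 1"
  defines "\<gamma> \<equiv> (1 - \<alpha>) / (2 - \<alpha>)"
  shows "\<bar>caputo_delta \<alpha> \<beta> c g x - g' x - L / 2 * (\<beta> - \<gamma>) * (x - c)\<bar>
    \<le> L / 2 * (\<bar>\<beta>\<bar> + \<gamma>) * \<bar>x - c\<bar>"
proof (cases c x rule: linorder_cases)
  case less
  then show ?thesis
    using caputo_delta_approx_right[OF g g' bd \<alpha> less, of \<beta>] by (simp add: \<gamma>_def)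
next
  case equal
  then show ?thesis
    using DERIV_imp_deriv[OF g] by (simp add: caputo_delta_def)
next
  case greater
  have r1: "((\<lambda>y. g (- y)) has_real_derivative - g' (- t)) (at t)" for t
    by (rule DERIV_reflect[OF g])
  have r2: "((\<lambda>y. - g' (- y)) has_real_derivative g'' (- t)) (at t)" for t
    using DERIV_minus[OF DERIV_reflect[OF g']] by simp
  have "- c < - x" "x \<noteq> c" using greater by auto
  then have "\<bar>- caputo_delta \<alpha> \<beta> c g x + g' x - L / 2 * (\<beta> - \<gamma>) * (- x + c)\<bar>
      \<le> L / 2 * (\<bar>\<beta>\<bar> + \<gamma>) * (- x + c)"
    using caputo_delta_approx_right[OF r1 r2 bd \<alpha>, of "- c" "- x" \<beta>]
      caputo_delta_reflect[OF g g' \<alpha>, of x c \<beta>]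
    by (simp add: \<gamma>_def)
  moreover have abs_eq: "\<bar>- d + p - k * (- x + c)\<bar> = \<bar>d - p - k * (x - c)\<bar>" for d p k
  proof -
    have "- d + p - k * (- x + c) = - (d - p - k * (x - c))" by (simp add: algebra_simps)
    then show ?thesis by (simp only: abs_minus_cancel)
  qed
  moreover have "\<bar>x - c\<bar> = - x + c" using greater by simp
  ultimately show ?thesis by (simp only: abs_eq)
qed

section \<open>Smooth convex functions of one variable\<close>

lemma derivative_nonneg_if_mono:
  fixes h :: "real \<Rightarrow> real"
  assumes "(h has_real_derivative d) (at t)" and "\<And>s. 0 \<le> (h s - h t) * (s - t)"
  shows "0 \<le> d"
proof (rule tendsto_lowerbound)
  show "((\<lambda>e. (h (t + e) - h t) / e) \<longlongrightarrow> d) (at 0)"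
    using assms(1) by (simp add: DERIV_def)
  show "\<forall>\<^sub>F e in at 0. 0 \<le> (h (t + e) - h t) / e"
    using assms(2)[of "t + _"] by (auto simp: zero_le_divide_iff zero_le_mult_iff)
qed simp

lemma derivative_le_if_increment_le:
  fixes h :: "real \<Rightarrow> real"
  assumes "(h has_real_derivative d) (at t)"
    and "\<And>s. (h s - h t) * (s - t) \<le> L * (s - t)\<^sup>2"
  shows "d \<le> L"
proof -
  have "((\<lambda>s. L * s - h s) has_real_derivative L - d) (at t)"
    using assms(1) by (auto intro!: derivative_eq_intros)
  moreover have "0 \<le> ((L * s - h s) - (L * t - h t)) * (s - t)" for s
    using assms(2)[of s] by (simp add: algebra_simps power2_eq_square)
  ultimately have "0 \<le> L - d" by (rule derivative_nonneg_if_mono)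
  then show ?thesis by simp
qed

text \<open>Adding each hypothesis to itself with \<open>s\<close> and \<open>t\<close> exchanged cancels the values of \<open>g\<close> and leaves
  bounds on the increments of \<open>g'\<close>.\<close>

lemma second_derivative_bounds:
  fixes g :: "real \<Rightarrow> real"
  assumes g: "\<And>t. (g has_real_derivative g' t) (at t)"
    and g': "(g' has_real_derivative d) (at t)"
    and tangent: "\<And>s t. g' s * (t - s) \<le> g t - g s"
    and smooth: "\<And>s t. g t - g s - g' s * (t - s) \<le> L / 2 * (t - s)\<^sup>2"
  shows "0 \<le> d" "d \<le> L"
proof -
  show "0 \<le> d"
  proof (rule derivative_nonneg_if_mono[OF g'])
    show "0 \<le> (g' s - g' t) * (s - t)" for s
      using tangent[of s t] tangent[of t s] by (simp add: algebra_simps)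
  qed
  show "d \<le> L"
  proof (rule derivative_le_if_increment_le[OF g'])
    show "(g' s - g' t) * (s - t) \<le> L * (s - t)\<^sup>2" for s
      using smooth[of s t] smooth[of t s] by (simp add: algebra_simps power2_eq_square)
  qed
qed

text \<open>The descent lemma gains \<open>s * d\<^sup>2 / 2\<close> with \<open>d = h' y\<close> as soon as \<open>s \<le> 1 / L\<close>, and after
  multiplication by \<open>2 * s\<close> this is exactly the
  quadratic term left over when the square of \<open>y - s * d - z\<close> is expanded.\<close>

lemma scaled_gradient_step:
  fixes h h' :: "real \<Rightarrow> real"
  assumes tangent: "h' y * (z - y) \<le> h z - h y"
    and smooth: "h (y - s * h' y) - h y - h' y * ((y - s * h' y) - y) \<le> L / 2 * ((y - s * h' y) - y)\<^sup>2"
    and s: "0 \<le> s" "s * L \<le> 1"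
  shows "2 * s * (h (y - s * h' y) - h z) \<le> (y - z)\<^sup>2 - (y - s * h' y - z)\<^sup>2"
proof -
  define d where "d = h' y"
  have "h (y - s * d) \<le> h y - s * d\<^sup>2 + (s * L) * (s * d\<^sup>2) / 2"
    using smooth by (simp add: d_def power2_eq_square algebra_simps)
  also have "(s * L) * (s * d\<^sup>2) \<le> 1 * (s * d\<^sup>2)"
    using s by (intro mult_right_mono) auto
  finally have "h (y - s * d) - h z \<le> d * (y - z) - s * d\<^sup>2 / 2"
    using tangent by (simp add: d_def algebra_simps)
  then have "2 * s * (h (y - s * d) - h z) \<le> 2 * s * (d * (y - z) - s * d\<^sup>2 / 2)"
    using s by (intro mult_left_mono) auto
  also have "\<dots> = (y - z)\<^sup>2 - (y - s * d - z)\<^sup>2"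
    by (simp add: power2_eq_square algebra_simps)
  finally show ?thesis by (simp add: d_def)
qed

section \<open>The step size and the telescoping argument\<close>

text \<open>With \<open>r = m / M\<close>, a number in \<open>(1 / sqrt 2, 1]\<close>, one has \<open>\<eta> * M * L = 2 * r - 1 / r\<close>, and this is
  at most \<open>1\<close> because \<open>(2 * r + 1) * (r - 1) \<le> 0\<close>.\<close>

lemma step_size_bounds:
  fixes m M L :: real
  assumes m: "0 < m" "m \<le> M" "M < sqrt 2 * m" and "L > 0"
  defines "\<eta> \<equiv> 1 / L * (2 * m / M\<^sup>2 - 1 / m)"
  shows "0 < \<eta>" "\<eta> * M * L \<le> 1" "2 * \<eta> * m = (4 * (m / M)\<^sup>2 - 2) / L"
    "0 < 4 * (m / M)\<^sup>2 - 2" "4 * (m / M)\<^sup>2 - 2 \<le> 2"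
proof -
  have M: "M > 0" using m by simp
  have "M\<^sup>2 < (sqrt 2 * m)\<^sup>2" using m M by (intro power_strict_mono) auto
  then have MM: "M\<^sup>2 < 2 * m\<^sup>2" by (simp add: power_mult_distrib)
  show e: "2 * \<eta> * m = (4 * (m / M)\<^sup>2 - 2) / L"
    using m M \<open>L > 0\<close> by (simp add: \<eta>_def field_simps power2_eq_square)
  show p: "0 < 4 * (m / M)\<^sup>2 - 2"
    using MM M by (simp add: power_divide field_simps)
  have "(m / M)\<^sup>2 \<le> 1" using m M by (simp add: power_le_one)
  then show "4 * (m / M)\<^sup>2 - 2 \<le> 2" by simp
  have "0 < 2 * \<eta> * m" unfolding e using p \<open>L > 0\<close> by simp
  then show "0 < \<eta>" using m by (simp add: zero_less_mult_iff)
  have "(2 * m + M) * (m - M) \<le> 0" using m M by (intro mult_nonneg_nonpos) auto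
  then have "2 * m\<^sup>2 - M\<^sup>2 \<le> m * M" by (simp add: power2_eq_square algebra_simps)
  moreover have "\<eta> * M * L = (2 * m\<^sup>2 - M\<^sup>2) / (m * M)"
    using m M \<open>L > 0\<close> by (simp add: \<eta>_def field_simps power2_eq_square)
  ultimately show "\<eta> * M * L \<le> 1" using m M by simp
qed

lemma average_iterate_bound:
  fixes f :: "'a::real_normed_vector \<Rightarrow> real" and x :: "nat \<Rightarrow> 'a"
  assumes "convex_on UNIV f" and "q > 0" and "T \<ge> 1"
    and step: "\<And>t. q * (f (x (Suc t)) - v) \<le> (norm (x t - z))\<^sup>2 - (norm (x (Suc t) - z))\<^sup>2"
  shows "f ((1 / real T) *\<^sub>R (\<Sum>t=1..T. x t)) - v \<le> (norm (x 0 - z))\<^sup>2 / (q * real T)"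
proof -
  have "(\<Sum>t=1..T. q * (f (x t) - v)) = (\<Sum>t<T. q * (f (x (Suc t)) - v))"
    by (rule sum.reindex_bij_witness[of _ Suc "\<lambda>t. t - 1"]) auto
  also have "\<dots> \<le> (\<Sum>t<T. (norm (x t - z))\<^sup>2 - (norm (x (Suc t) - z))\<^sup>2)"
    by (intro sum_mono step)
  also have "\<dots> = (norm (x 0 - z))\<^sup>2 - (norm (x T - z))\<^sup>2"
    by (rule sum_lessThan_telescope')
  also have "\<dots> \<le> (norm (x 0 - z))\<^sup>2" by simp
  finally have tel: "q * ((\<Sum>t=1..T. f (x t)) - real T * v) \<le> (norm (x 0 - z))\<^sup>2"
    by (simp add: sum_distrib_left[symmetric] sum_subtractf)
  have "f (\<Sum>t=1..T. (1 / real T) *\<^sub>R x t) \<le> (\<Sum>t=1..T. (1 / real T) * f (x t))"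
    using assms by (intro convex_on_sum[OF _ _ assms(1)]) auto
  then have "f ((1 / real T) *\<^sub>R (\<Sum>t=1..T. x t)) \<le> (\<Sum>t=1..T. f (x t)) / real T"
    by (simp add: scaleR_sum_right sum_divide_distrib)
  then have "f ((1 / real T) *\<^sub>R (\<Sum>t=1..T. x t)) - v \<le> ((\<Sum>t=1..T. f (x t)) - real T * v) / real T"
    using \<open>T \<ge> 1\<close> by (simp add: diff_divide_distrib)
  also have "\<dots> \<le> (norm (x 0 - z))\<^sup>2 / (q * real T)"
    unfolding divide_divide_eq_left[symmetric]
    using tel \<open>q > 0\<close> by (intro divide_right_mono) (simp_all add: field_simps)
  finally show ?thesis .
qed

section \<open>Coordinate functions of a separable function\<close>

lemma separable_along_axis:
  fixes f :: "real ^ 'k::finite \<Rightarrow> real"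
  assumes sep: "f = (\<lambda>y. \<Sum>i\<in>UNIV. fi i (y $ i))"
  shows "f (u + (y - u $ j) *\<^sub>R axis j 1) = fi j y + (f u - fi j (u $ j))"
proof -
  have "f (u + (y - u $ j) *\<^sub>R axis j 1) = fi j y + (\<Sum>i\<in>UNIV - {j}. fi i (u $ i))"
    unfolding sep by (subst sum.remove[of _ j]) (auto simp: axis_def intro!: sum.cong)
  moreover have "f u = fi j (u $ j) + (\<Sum>i\<in>UNIV - {j}. fi i (u $ i))"
    unfolding sep by (subst sum.remove[of _ j]) auto
  ultimately show ?thesis by simp
qed

lemma DERIV_along_axis:
  fixes f :: "real ^ 'k::finite \<Rightarrow> real"
  assumes "f differentiable (at (u + (t - u $ j) *\<^sub>R axis j 1))"
  shows "((\<lambda>y. f (u + (y - u $ j) *\<^sub>R axis j 1)) has_real_derivative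
    grad f (u + (t - u $ j) *\<^sub>R axis j 1) $ j) (at t)"
proof -
  have "((\<lambda>y. u + (y - u $ j) *\<^sub>R axis j 1) has_derivative (\<lambda>h. h *\<^sub>R axis j 1)) (at t)"
    by (auto intro!: derivative_eq_intros)
  from has_derivative_compose[OF this GDERIV_grad[OF assms, unfolded gderiv_def]]
  show ?thesis
    by (rule has_derivative_imp_has_field_derivative) (simp add: inner_axis' mult.commute)
qed

lemma DERIV_coordinate_function:
  fixes f :: "real ^ 'k::finite \<Rightarrow> real"
  assumes sep: "f = (\<lambda>y. \<Sum>i\<in>UNIV. fi i (y $ i))"
    and diff: "\<And>x. f differentiable (at x)"
  shows "(fi j has_real_derivative grad f (u + (t - u $ j) *\<^sub>R axis j 1) $ j) (at t)"
proof -
  have "fi j = (\<lambda>y. f (u + (y - u $ j) *\<^sub>R axis j 1) - (f u - fi j (u $ j)))"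
    by (simp add: separable_along_axis[OF sep] fun_eq_iff)
  moreover have "((\<lambda>y. f (u + (y - u $ j) *\<^sub>R axis j 1) - (f u - fi j (u $ j))) has_real_derivative
      grad f (u + (t - u $ j) *\<^sub>R axis j 1) $ j) (at t)"
    using DERIV_diff[OF DERIV_along_axis[OF diff] DERIV_const] by simp
  ultimately show ?thesis by simp
qed

lemma DERIV_grad_component_along_axis:
  fixes f :: "real ^ 'k::finite \<Rightarrow> real"
  assumes "\<And>x. grad f differentiable (at x)"
  shows "\<exists>d. ((\<lambda>t. grad f (t *\<^sub>R axis j 1) $ j) has_real_derivative d) (at t)"
proof -
  have "(\<lambda>t. grad f (t *\<^sub>R axis j 1)) differentiable (at t)"
    by (rule differentiable_compose[OF assms]) (auto intro!: derivative_intros)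
  then have "(\<lambda>t. grad f (t *\<^sub>R axis j 1) $ j) differentiable (at t)"
    unfolding differentiable_def
    using bounded_linear.has_derivative[OF bounded_linear_vec_nth[of j]] by fast
  then show ?thesis
    by (simp add: real_differentiable_def)
qed

text \<open>Restricted to the \<open>j\<close>-th axis, \<open>f\<close> is \<open>fi j\<close> up to an additive constant, so \<open>fi j\<close> inherits
  convexity and smoothness.\<close>

lemma coordinate_function_tangent_smooth:
  fixes f :: "real ^ 'k::finite \<Rightarrow> real"
  assumes sep: "f = (\<lambda>y. \<Sum>i\<in>UNIV. fi i (y $ i))"
    and diff: "\<And>x. f differentiable (at x)"
    and smooth: "L_smooth L f" and convex: "convex_on UNIV f"
    and fi': "(fi j has_real_derivative d) (at s)"
  shows "d * (t - s) \<le> fi j t - fi j s" "fi j t - fi j s - d * (t - s) \<le> L / 2 * (t - s)\<^sup>2"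
proof -
  have fj: "f (y *\<^sub>R axis j 1) = fi j y + (f 0 - fi j 0)" for y
    using separable_along_axis[OF sep, of 0 y j] by simp
  have "convex_on UNIV (fi j)"
  proof (rule convex_onI)
    fix u a b :: real assume u: "0 < u" "u < 1"
    have "f ((1 - u) *\<^sub>R (a *\<^sub>R axis j 1) + u *\<^sub>R (b *\<^sub>R axis j 1))
        \<le> (1 - u) * f (a *\<^sub>R axis j 1) + u * f (b *\<^sub>R axis j 1)"
      using u by (intro convex_onD[OF convex]) auto
    also have "(1 - u) *\<^sub>R (a *\<^sub>R axis j 1) + u *\<^sub>R (b *\<^sub>R axis j 1)
        = ((1 - u) *\<^sub>R a + u *\<^sub>R b) *\<^sub>R axis j 1"
      by (simp add: scaleR_add_left)
    finally show "fi j ((1 - u) *\<^sub>R a + u *\<^sub>R b) \<le> (1 - u) * fi j a + u * fi j b"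
      unfolding fj by (simp add: algebra_simps)
  qed simp
  from convex_on_imp_above_tangent[OF this _ _ _ fi', of t]
  show "d * (t - s) \<le> fi j t - fi j s" by simp
  have "d = grad f (s *\<^sub>R axis j 1) $ j"
    using DERIV_unique[OF fi' DERIV_coordinate_function[OF sep diff, of j 0 s]] by simp
  moreover have "norm (t *\<^sub>R axis j 1 - s *\<^sub>R axis j (1::real) :: real ^ 'k) = \<bar>t - s\<bar>"
    by (simp flip: scaleR_diff_left)
  moreover have "grad f (s *\<^sub>R axis j 1) \<bullet> (t *\<^sub>R axis j 1 - s *\<^sub>R axis j 1)
      = grad f (s *\<^sub>R axis j 1) $ j * (t - s)"
    by (simp add: inner_axis flip: scaleR_diff_left)
  moreover have "f (t *\<^sub>R axis j 1) - f (s *\<^sub>R axis j 1)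
      - grad f (s *\<^sub>R axis j 1) \<bullet> (t *\<^sub>R axis j 1 - s *\<^sub>R axis j 1)
      \<le> L / 2 * (norm (t *\<^sub>R axis j 1 - s *\<^sub>R axis j 1 :: real ^ 'k))\<^sup>2"
    using smooth unfolding L_smooth_def by (meson abs_le_D1)
  ultimately show "fi j t - fi j s - d * (t - s) \<le> L / 2 * (t - s)\<^sup>2"
    by (simp add: fj)
qed


section \<open>The convergence rate\<close>

theorem theorem5p1:
  fixes f :: "real ^ 'k::finite \<Rightarrow> real"
    and fi :: "'k \<Rightarrow> real \<Rightarrow> real"
    and x c :: "nat \<Rightarrow> real ^ 'k"
    and xstar :: "real ^ 'k"
    and L \<alpha> \<beta> \<gamma> K1 K2 lam \<eta> :: real
  assumes "twice_differentiable f"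
    and "L > 0" and "L_smooth L f"
    and "convex_on UNIV f"
    and "\<forall>y. f xstar \<le> f y"
    and "\<forall>y. f y = (\<Sum>i\<in>UNIV. fi i (y $ i))"
    and "0 < \<alpha>" and "\<alpha> < 1"
    and "\<gamma> = (1 - \<alpha>) / (2 - \<alpha>)"
    and "K1 = L / 2 * (\<beta> - \<gamma>)"
    and "K2 = (if \<beta> \<ge> 0 then L / 2 * (\<beta> + \<gamma>) else - (L / 2) * (\<beta> - \<gamma>))"
    and "1 - lam * K1 > (sqrt 2 + 1) / (sqrt 2 - 1) * \<bar>lam\<bar> * K2"
    and "\<eta> = 1 / L * (2 * (1 - lam * K1 - \<bar>lam\<bar> * K2) / (1 - lam * K1 + \<bar>lam\<bar> * K2)\<^sup>2
                      - 1 / (1 - lam * K1 - \<bar>lam\<bar> * K2))"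
    and "\<forall>t. x t - c t = - lam *\<^sub>R grad f (x t)"
    and "\<forall>t. x (Suc t) = x t - \<eta> *\<^sub>R caputo_grad \<alpha> \<beta> (c t) f (x t)"
  shows "(\<forall>T\<ge>1. f ((1 / real T) *\<^sub>R (\<Sum>t=1..T. x t)) - f xstar
            \<le> L * (norm (x 0 - xstar))\<^sup>2 /
               ((4 * ((1 - lam * K1 - \<bar>lam\<bar> * K2) / (1 - lam * K1 + \<bar>lam\<bar> * K2))\<^sup>2 - 2) * real T))
       \<and> L / (4 * ((1 - lam * K1 - \<bar>lam\<bar> * K2) / (1 - lam * K1 + \<bar>lam\<bar> * K2))\<^sup>2 - 2) \<ge> L / 2"
proof -
  define m where "m = 1 - lam * K1 - \<bar>lam\<bar> * K2"
  define M where "M = 1 - lam * K1 + \<bar>lam\<bar> * K2"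
  note \<alpha> = \<open>0 < \<alpha>\<close> \<open>\<alpha> < 1\<close>
  have "\<gamma> > 0" using assms(7-9) by simp
  have K2: "K2 = L / 2 * (\<bar>\<beta>\<bar> + \<gamma>)"
    unfolding assms(11) by (auto simp: field_simps)
  have "\<bar>lam\<bar> * K2 \<ge> 0"
    using \<open>\<gamma> > 0\<close> \<open>L > 0\<close> by (simp add: K2)
  then have mM: "m \<le> M" by (simp add: m_def M_def)
  have sq: "sqrt 2 > (1::real)" by simp
  have "(sqrt 2 + 1) * (\<bar>lam\<bar> * K2) < (1 - lam * K1) * (sqrt 2 - 1)"
    using assms(12) sq by (simp add: field_simps)
  then have Mm: "M < sqrt 2 * m" by (simp add: m_def M_def algebra_simps)
  then have "0 < (sqrt 2 - 1) * m" using mM by (simp add: algebra_simps)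
  then have m0: "0 < m" using sq by (simp add: zero_less_mult_iff)
  have \<eta>: "\<eta> = 1 / L * (2 * m / M\<^sup>2 - 1 / m)"
    unfolding assms(13) m_def M_def ..
  note step = step_size_bounds[OF m0 mM Mm \<open>L > 0\<close>, folded \<eta>]

  have sep: "f = (\<lambda>y. \<Sum>i\<in>UNIV. fi i (y $ i))" using assms(6) by blast
  have diff: "\<And>x. f differentiable (at x)" and diff2: "\<And>x. grad f differentiable (at x)"
    using assms(1) by (auto simp: twice_differentiable_def)
  define f' where "f' = (\<lambda>j t. grad f (t *\<^sub>R axis j 1) $ j)"
  have f': "(fi j has_real_derivative f' j t) (at t)" for j t
    unfolding f'_def using DERIV_coordinate_function[OF sep diff, of j 0 t] by simp
  have grad: "grad f u $ j = f' j (u $ j)" for u j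
    using DERIV_unique[OF f' DERIV_coordinate_function[OF sep diff, of j u "u $ j"]] by simp
  define f'' where "f'' = (\<lambda>j t. SOME d. (f' j has_real_derivative d) (at t))"
  have f'': "(f' j has_real_derivative f'' j t) (at t)" for j t
    unfolding f''_def f'_def by (rule someI_ex[OF DERIV_grad_component_along_axis[OF diff2]])
  note ts = coordinate_function_tangent_smooth[OF sep diff \<open>L_smooth L f\<close> \<open>convex_on UNIV f\<close> f']
  note bd = second_derivative_bounds[OF f' f'' ts]
  have fmin: "fi j (xstar $ j) \<le> fi j y" for j y
    using assms(5) separable_along_axis[OF sep, of xstar y j] by (metis add_le_cancel_right diff_add_cancel
      add_diff_eq add.commute)

  have coord: "2 * \<eta> * m * (fi j (x (Suc t) $ j) - fi j (xstar $ j))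
      \<le> (x t $ j - xstar $ j)\<^sup>2 - (x (Suc t) $ j - xstar $ j)\<^sup>2" for t j
  proof -
    define y where "y = x t $ j"
    define d where "d = f' j y"
    define \<delta> where "\<delta> = caputo_delta \<alpha> \<beta> (c t $ j) (coord_restrict f j (x t)) y"
    have g: "(coord_restrict f j (x t) has_real_derivative f' j s) (at s)" for s
    proof -
      have "coord_restrict f j (x t) = (\<lambda>y. fi j y + (f (x t) - fi j (x t $ j)))"
        by (simp add: coord_restrict_def separable_along_axis[OF sep] fun_eq_iff)
      then show ?thesis by (auto intro!: derivative_eq_intros f')
    qed
    have yc: "y - c t $ j = - lam * d"
      using arg_cong[OF assms(14)[rule_format, of t], of "\<lambda>v. v $ j"] by (simp add: y_def d_def grad)
    have "\<bar>\<delta> - d - K1 * (- lam * d)\<bar> \<le> K2 * \<bar>- lam * d\<bar>"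
      using caputo_delta_approx[OF g f'' bd \<alpha>, of \<beta> "c t $ j" y]
      unfolding yc by (simp add: \<delta>_def d_def assms(9,10) K2)
    then have err: "\<bar>\<delta> - (1 - lam * K1) * d\<bar> \<le> \<bar>lam\<bar> * K2 * \<bar>d\<bar>"
      by (simp add: abs_mult algebra_simps)
    (* At a critical point the error bound forces \<delta> = 0, and any factor in [m, M] will do. *)
    obtain A where A: "m \<le> A" "A \<le> M" "\<delta> = A * d"
    proof (cases "d = 0")
      case True
      then show ?thesis using that[of m] err mM by simp
    next
      case False
      have "\<bar>\<delta> / d - (1 - lam * K1)\<bar> * \<bar>d\<bar> \<le> \<bar>lam\<bar> * K2 * \<bar>d\<bar>"
        using err False by (simp add: left_diff_distrib flip: abs_mult)
      then have "\<bar>\<delta> / d - (1 - lam * K1)\<bar> \<le> \<bar>lam\<bar> * K2" using False by simp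
      then show ?thesis using that[of "\<delta> / d"] False by (simp add: m_def M_def)
    qed
    have upd: "x (Suc t) $ j = y - \<eta> * A * d"
      using assms(15) A(3) by (simp add: caputo_grad_def \<delta>_def y_def)
    have "\<eta> * A * L \<le> \<eta> * M * L"
      using A step(1) \<open>L > 0\<close> by (intro mult_right_mono mult_left_mono) auto
    then have s: "0 \<le> \<eta> * A" "\<eta> * A * L \<le> 1"
      using step(1,2) A m0 by (simp_all only: zero_le_mult_iff) linarith+
    (* Lowering A to m is legitimate because xstar minimizes fi j in its j-th coordinate. *)
    have "2 * \<eta> * m * (fi j (y - \<eta> * A * d) - fi j (xstar $ j))
        \<le> 2 * (\<eta> * A) * (fi j (y - \<eta> * A * d) - fi j (xstar $ j))"
      using A step(1) fmin[of j] by (intro mult_right_mono) auto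
    also have "\<dots> \<le> (y - xstar $ j)\<^sup>2 - (y - \<eta> * A * d - xstar $ j)\<^sup>2"
      unfolding d_def
      by (rule scaled_gradient_step[where h = "fi j" and h' = "f' j", OF ts(1) ts(2) s])
    finally show ?thesis by (simp add: upd flip: y_def)
  qed

  have norm: "(norm v)\<^sup>2 = (\<Sum>j\<in>UNIV. (v $ j)\<^sup>2)" for v :: "real ^ 'k"
    by (simp only: power2_norm_eq_inner inner_vec_def) (simp add: power2_eq_square)
  have descent: "2 * \<eta> * m * (f (x (Suc t)) - f xstar)
      \<le> (norm (x t - xstar))\<^sup>2 - (norm (x (Suc t) - xstar))\<^sup>2" for t
  proof -
    have "2 * \<eta> * m * (f (x (Suc t)) - f xstar)
        = (\<Sum>j\<in>UNIV. 2 * \<eta> * m * (fi j (x (Suc t) $ j) - fi j (xstar $ j)))"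
      unfolding sep by (simp add: sum_distrib_left sum_subtractf right_diff_distrib)
    also have "\<dots> \<le> (\<Sum>j\<in>UNIV. (x t $ j - xstar $ j)\<^sup>2 - (x (Suc t) $ j - xstar $ j)\<^sup>2)"
      by (intro sum_mono coord)
    also have "\<dots> = (norm (x t - xstar))\<^sup>2 - (norm (x (Suc t) - xstar))\<^sup>2"
      by (simp add: norm sum_subtractf)
    finally show ?thesis .
  qed
  have "f ((1 / real T) *\<^sub>R (\<Sum>t=1..T. x t)) - f xstar
      \<le> L * (norm (x 0 - xstar))\<^sup>2 / ((4 * (m / M)\<^sup>2 - 2) * real T)" if "T \<ge> 1" for T
  proof -
    have "2 * \<eta> * m > 0" using step(1) m0 by simp
    from average_iterate_bound[where x = x and v = "f xstar" and z = xstar,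
        OF \<open>convex_on UNIV f\<close> this that descent]
    show ?thesis unfolding step(3) using \<open>L > 0\<close> by (simp add: mult.commute)
  qed
  moreover have "L / 2 \<le> L / (4 * (m / M)\<^sup>2 - 2)"
    using step(4,5) \<open>L > 0\<close> by (intro divide_left_mono) auto
  ultimately show ?thesis unfolding m_def M_def by blast
qed

end
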